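(* Let $n\ge 3$ and $0\le r\le n-3$. If $G$ is a connected graph of order $n$ with exactly $r$ cut edges whose Sombor index $SO(G)$ is maximum among all connected graphs of order $n$ with exactly $r$ cut edges, then $G$ is isomorphic to the graph obtained by attaching $r$ pendent edges to one vertex of the complete graph $K_{n-r}$.
   Context: For a graph $G$, $d_G(w)$ denotes the degree of vertex $w$, and the Sombor index is $SO(G)=\sum_{ab\in E(G)}\sqrt{d_G(a)^2+d_G(b)^2}$. A cut edge is an edge whose deletion disconnects the graph. $K_m$ denotes the complete graph on $m$ vertices. *)

theory Defs
  imports Complex_Main
begin

definition simple_graph :: "'a set \<Rightarrow> 'a set set \<Rightarrow> bool" where
  "simple_graph V E \<longleftrightarrow> finite V \<and> (\<forall>e\<in>E. e \<subseteq> V \<and> card e = 2)"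

definition degree :: "'a set set \<Rightarrow> 'a \<Rightarrow> nat" where
  "degree E v = card {e \<in> E. v \<in> e}"

definition adj :: "'a set set \<Rightarrow> 'a \<Rightarrow> 'a \<Rightarrow> bool" where
  "adj E u v \<longleftrightarrow> {u, v} \<in> E"

definition connected_graph :: "'a set \<Rightarrow> 'a set set \<Rightarrow> bool" where
  "connected_graph V E \<longleftrightarrow> V \<noteq> {} \<and> (\<forall>u\<in>V. \<forall>v\<in>V. (adj E)\<^sup>*\<^sup>* u v)"

definition cut_edge :: "'a set \<Rightarrow> 'a set set \<Rightarrow> 'a set \<Rightarrow> bool" where
  "cut_edge V E e \<longleftrightarrow> e \<in> E \<and> \<not> connected_graph V (E - {e})"

definition num_cut_edges :: "'a set \<Rightarrow> 'a set set \<Rightarrow> nat" where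
  "num_cut_edges V E = card {e \<in> E. cut_edge V E e}"

definition sombor :: "'a set set \<Rightarrow> real" where
  "sombor E = (\<Sum>e\<in>E. sqrt (\<Sum>v\<in>e. (real (degree E v))^2))"

definition graph_iso :: "'a set \<Rightarrow> 'a set set \<Rightarrow> 'b set \<Rightarrow> 'b set set \<Rightarrow> bool" where
  "graph_iso V E W F \<longleftrightarrow> (\<exists>f. bij_betw f V W \<and>
      (\<forall>e. e \<subseteq> V \<longrightarrow> (e \<in> E \<longleftrightarrow> f ` e \<in> F)))"

text \<open>K_{n-r} on vertices 0..n-r-1, plus r pendent edges {0,j} for n-r \<le> j < n.\<close>
definition kpend_vertices :: "nat \<Rightarrow> nat set" where
  "kpend_vertices n = {0..<n}"

definition kpend_edges :: "nat \<Rightarrow> nat \<Rightarrow> nat set set" where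
  "kpend_edges n r = {{i, j} | i j. i < j \<and> j < n - r} \<union> {{0, j} | j. n - r \<le> j \<and> j < n}"

end

theory Submission
  imports Defs
begin

text \<open>The Sombor index is bounded edge by edge. Let \<open>r\<close> be the number of cut edges and
  \<open>m = n - r - 1\<close>. The ends of a cut edge have no common neighbour, so their degrees sum to at
  most \<open>n\<close> and the edge contributes at most \<open>sqrt ((n - 1)^2 + 1)\<close>. Deleting the cut edges leaves
  at least \<open>r + 1\<close> components, so for a non-cut edge \<open>uv\<close> the degrees are at most \<open>m + b u\<close> and
  \<open>m + b v\<close>, where \<open>b\<close> counts incident cut edges and \<open>b u + b v \<le> r\<close>. Convexity of the Euclidean
  norm bounds its contribution by an affine function of \<open>b u + b v\<close>. Summing this by double
  counting, and bounding the number of non-cut edges by \<open>(m + 1) choose 2\<close>, gives exactly the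
  value of the clique with pendent edges at one vertex. In the equality case every cut edge is
  pendent at a vertex adjacent to all others, and the remaining edges form a clique.\<close>

section \<open>Simple graphs: neighbourhoods, degrees and double counting\<close>

lemma simple_graphE:
  assumes "simple_graph V E" "e \<in> E"
  obtains u v where "e = {u, v}" "u \<noteq> v" "u \<in> V" "v \<in> V"
  using assms unfolding simple_graph_def by (metis card_2_iff insert_subset)

lemma simple_graph_finite:
  assumes "simple_graph V E"
  shows "finite V" "finite E"
proof -
  show V: "finite V" using assms by (simp add: simple_graph_def)
  have "E \<subseteq> Pow V" using assms by (auto simp: simple_graph_def)
  then show "finite E" using V finite_subset by blast
qed

lemma simple_graph_subset: "simple_graph V E \<Longrightarrow> F \<subseteq> E \<Longrightarrow> simple_graph V F"
  by (auto simp: simple_graph_def)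

lemma degree_eq_card_neighbours:
  assumes "simple_graph V E"
  shows "degree E v = card {w. {v, w} \<in> E}"
proof -
  have "bij_betw (\<lambda>w. {v, w}) {w. {v, w} \<in> E} {e \<in> E. v \<in> e}"
  proof (rule bij_betw_imageI)
    show "inj_on (\<lambda>w. {v, w}) {w. {v, w} \<in> E}"
      by (auto simp: inj_on_def doubleton_eq_iff)
    show "(\<lambda>w. {v, w}) ` {w. {v, w} \<in> E} = {e \<in> E. v \<in> e}"
      using simple_graphE[OF assms] by (auto simp: image_iff) (metis insertE insert_commute singletonD)
  qed
  then show ?thesis by (simp add: degree_def bij_betw_same_card)
qed

lemma neighbours_subset:
  assumes "simple_graph V E"
  shows "{w. {v, w} \<in> E} \<subseteq> V - {v}"
  using assms by (force simp: simple_graph_def)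

lemma degree_split:
  assumes "finite E" "B \<subseteq> E"
  shows "degree E v = degree (E - B) v + degree B v"
proof -
  have "{e \<in> E. v \<in> e} = {e \<in> E - B. v \<in> e} \<union> {e \<in> B. v \<in> e}" using assms by auto
  then show ?thesis unfolding degree_def
    using assms by (simp add: card_Un_disjoint disjoint_iff finite_subset)
qed

text \<open>Both sides count incident pairs of a vertex and an edge, weighted by \<open>g\<close>. A
  constant \<open>g\<close> gives the handshake lemma; \<open>g\<close> a degree in another edge set
  lets two edge sets trade places.\<close>

lemma sum_over_edge_ends:
  fixes g :: "'a \<Rightarrow> nat"
  assumes "simple_graph V E"
  shows "(\<Sum>e\<in>E. \<Sum>v\<in>e. g v) = (\<Sum>v\<in>V. degree E v * g v)"
proof -
  note fin = simple_graph_finite[OF assms]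
  have "(\<Sum>e\<in>E. \<Sum>v\<in>e. g v) = (\<Sum>e\<in>E. \<Sum>v | v \<in> V \<and> v \<in> e. g v)"
    using assms by (intro sum.cong) (auto simp: simple_graph_def)
  also have "\<dots> = (\<Sum>v\<in>V. \<Sum>e | e \<in> E \<and> v \<in> e. g v)"
    using fin by (intro sum.swap_restrict)
  finally show ?thesis by (simp add: degree_def)
qed

lemma handshake:
  assumes "simple_graph V E"
  shows "2 * card E = (\<Sum>v\<in>V. degree E v)"
proof -
  have "(\<Sum>e\<in>E. \<Sum>v\<in>e. (1::nat)) = (\<Sum>e\<in>E. 2)"
    using assms by (intro sum.cong) (auto simp: simple_graph_def)
  then show ?thesis using sum_over_edge_ends[OF assms, of "\<lambda>_. 1"] by simp
qed

section \<open>Reachability, cut edges and components\<close>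

lemma reach_sym: "(adj E)\<^sup>*\<^sup>* u v \<Longrightarrow> (adj E)\<^sup>*\<^sup>* v u"
proof (induction rule: rtranclp_induct)
  case (step y z)
  then have "adj E z y" by (simp add: adj_def insert_commute)
  then show ?case using step by (meson converse_rtranclp_into_rtranclp)
qed simp

lemma reach_mono: "F \<subseteq> E \<Longrightarrow> (adj F)\<^sup>*\<^sup>* u v \<Longrightarrow> (adj E)\<^sup>*\<^sup>* u v"
  by (rule rtranclp_mono[THEN predicate2D]) (auto simp: adj_def)

lemma connected_graphI:
  assumes "a \<in> V" "\<And>v. v \<in> V \<Longrightarrow> (adj E)\<^sup>*\<^sup>* a v"
  shows "connected_graph V E"
  unfolding connected_graph_def using assms by (meson empty_iff reach_sym rtranclp_trans)

text \<open>By definition, deleting a cut edge only disconnects some pair of vertices. That pair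
  must include the ends: a walk from \<open>a\<close> to \<open>b\<close> avoiding the edge could
  replace every use of the edge, so nothing would be disconnected.\<close>

lemma cut_edge_separates:
  assumes "connected_graph V E" "cut_edge V E {a, b}"
  shows "\<not> (adj (E - {{a, b}}))\<^sup>*\<^sup>* a b"
proof
  let ?R = "(adj (E - {{a, b}}))\<^sup>*\<^sup>*"
  assume ab: "?R a b"
  have step: "?R u v" if "adj E u v" for u v
  proof (cases "{u, v} = {a, b}")
    case True
    then show ?thesis using ab reach_sym[OF ab] by (auto simp: doubleton_eq_iff)
  next
    case False
    then have "adj (E - {{a, b}}) u v" using that by (simp add: adj_def)
    then show ?thesis by simp
  qed
  have "?R u v" if "(adj E)\<^sup>*\<^sup>* u v" for u v
    using that by (induction rule: rtranclp_induct) (auto intro: step rtranclp_trans)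
  then have "connected_graph V (E - {{a, b}})"
    using assms(1) by (auto simp: connected_graph_def)
  then show False using assms(2) by (simp add: cut_edge_def)
qed

definition component :: "'a set \<Rightarrow> 'a set set \<Rightarrow> 'a \<Rightarrow> 'a set" where
  "component V E v = {w \<in> V. (adj E)\<^sup>*\<^sup>* v w}"

lemma component_eq_iff:
  assumes "u \<in> V" "v \<in> V"
  shows "component V E u = component V E v \<longleftrightarrow> (adj E)\<^sup>*\<^sup>* u v"
  unfolding component_def using assms
  by (auto simp: set_eq_iff) (meson reach_sym rtranclp_trans)+

text \<open>Components after deletion map onto the components before it, each to the one containing
  it. The components of \<open>a\<close> and \<open>b\<close> are merged by this map, so the count
  strictly drops along it.\<close>

lemma card_components_remove:
  assumes "finite V" "a \<in> V" "b \<in> V" "{a, b} \<in> E" "\<not> (adj (E - {{a, b}}))\<^sup>*\<^sup>* a b"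
  shows "card (component V E ` V) < card (component V (E - {{a, b}}) ` V)"
proof -
  let ?F = "E - {{a, b}}"
  \<comment> \<open>\<open>g\<close> closes a set under reachability in the larger graph, which
    gives the containing component without choosing a representative.\<close>
  define g where "g C = {w \<in> V. \<exists>v\<in>C. (adj E)\<^sup>*\<^sup>* v w}" for C
  have g: "g (component V ?F v) = component V E v" if "v \<in> V" for v
    unfolding g_def component_def using that reach_mono[of ?F E]
    by auto (meson Diff_subset rtranclp_trans)
  have im: "g ` component V ?F ` V = component V E ` V"
    using g by (simp add: image_image)
  have "(adj E)\<^sup>*\<^sup>* a b" using assms by (auto simp: adj_def)
  then have "g (component V ?F a) = g (component V ?F b)"
    using assms by (simp add: g component_eq_iff)
  moreover have "component V ?F a \<noteq> component V ?F b"
    using assms by (simp add: component_eq_iff)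
  ultimately have "\<not> inj_on g (component V ?F ` V)"
    using assms(2,3) by (meson imageI inj_onD)
  then have "card (g ` component V ?F ` V) \<noteq> card (component V ?F ` V)"
    using assms(1) eq_card_imp_inj_on by blast
  moreover have "card (g ` component V ?F ` V) \<le> card (component V ?F ` V)"
    using assms(1) by (intro card_image_le) auto
  ultimately show ?thesis using im by simp
qed

text \<open>Deleting the edges of \<open>S\<close> one at a time, each deletion adds a component:
  the ends of \<open>e\<close> are already separated in \<open>E - {e}\<close>, and having fewer
  edges keeps them separated.\<close>

lemma card_components_remove_cut_edges:
  assumes sg: "simple_graph V E" and con: "connected_graph V E"
    and "finite S" "S \<subseteq> {e \<in> E. cut_edge V E e}"
  shows "card S + 1 \<le> card (component V (E - S) ` V)"
  using assms(3,4)
proof (induction S rule: finite_induct)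
  case empty
  have "V \<noteq> {}" "finite V" using con sg by (auto simp: connected_graph_def simple_graph_def)
  then have "card (component V E ` V) \<noteq> 0" by simp
  then show ?case by simp
next
  case (insert e S)
  obtain a b where ab: "e = {a, b}" "a \<in> V" "b \<in> V"
    using insert.prems simple_graphE[OF sg, of e] by blast
  have "\<not> (adj (E - {e}))\<^sup>*\<^sup>* a b"
    using cut_edge_separates[OF con] insert.prems ab by auto
  then have "\<not> (adj (E - S - {{a, b}}))\<^sup>*\<^sup>* a b"
    using reach_mono[of "E - S - {{a, b}}" "E - {e}"] ab by blast
  then have "card (component V (E - S) ` V) < card (component V (E - S - {{a, b}}) ` V)"
    using insert ab sg by (intro card_components_remove) (auto simp: simple_graph_def)
  moreover have "E - S - {{a, b}} = E - insert e S" using ab by auto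
  ultimately show ?case using insert by simp
qed

text \<open>A labelling that is constant along edges plays the role of the map to components;
  the bounds below then only depend on the number of labels.\<close>

locale edge_constant_labelling =
  fixes V :: "'a set" and E :: "'a set set" and h :: "'a \<Rightarrow> 'b" and m :: nat
  assumes simple: "simple_graph V E"
    and const_on_edges: "{u, v} \<in> E \<Longrightarrow> h u = h v"
    and many_labels: "card V \<le> m + card (h ` V)"
begin

definition fibre :: "'b \<Rightarrow> 'a set" where "fibre y = {v \<in> V. h v = y}"

lemma finite_fibre: "finite (fibre y)"
  using simple by (simp add: fibre_def simple_graph_def)

text \<open>The sum equals \<open>card V\<close> minus the number of labels. Fibres over labels in
  use are nonempty, so the truncated subtraction of 1 is exact.\<close>

lemma sum_fibres: "(\<Sum>y\<in>h ` V. card (fibre y) - 1) \<le> m"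
proof -
  have fin: "finite V" using simple by (simp add: simple_graph_def)
  have "card V = (\<Sum>y\<in>h ` V. card (fibre y))"
    using sum.image_gen[OF fin, of "\<lambda>_. 1::nat" h] by (simp add: fibre_def)
  also have "\<dots> = (\<Sum>y\<in>h ` V. (card (fibre y) - 1) + 1)"
  proof (rule sum.cong)
    fix y assume "y \<in> h ` V"
    then have "card (fibre y) \<noteq> 0" using finite_fibre by (auto simp: fibre_def)
    then show "card (fibre y) = card (fibre y) - 1 + 1" by simp
  qed simp
  also have "\<dots> = (\<Sum>y\<in>h ` V. card (fibre y) - 1) + card (h ` V)"
    by (simp only: sum.distrib) simp
  finally show ?thesis using many_labels by simp
qed

lemma degree_le_fibre:
  assumes "v \<in> V"
  shows "degree E v \<le> card (fibre (h v)) - 1"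
proof -
  have "{w. {v, w} \<in> E} \<subseteq> fibre (h v) - {v}"
    using neighbours_subset[OF simple, of v] const_on_edges by (auto simp: fibre_def)
  then have "degree E v \<le> card (fibre (h v) - {v})"
    unfolding degree_eq_card_neighbours[OF simple]
    by (intro card_mono) (auto simp: finite_fibre)
  then show ?thesis using assms by (simp add: fibre_def)
qed

lemma degree_le:
  assumes "v \<in> V"
  shows "degree E v \<le> m"
proof -
  have "card (fibre (h v)) - 1 \<le> (\<Sum>y\<in>h ` V. card (fibre y) - 1)"
    using assms simple by (intro member_le_sum) (auto simp: simple_graph_def)
  then show ?thesis using degree_le_fibre[OF assms] sum_fibres by linarith
qed

text \<open>The fibres of \<open>u\<close> and \<open>v\<close> are distinct summands of the total
  bounded in \<open>sum_fibres\<close>.\<close>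

lemma degree_add_le:
  assumes "u \<in> V" "v \<in> V" "h u \<noteq> h v"
  shows "degree E u + degree E v \<le> m"
proof -
  have "(\<Sum>y\<in>{h u, h v}. card (fibre y) - 1) \<le> (\<Sum>y\<in>h ` V. card (fibre y) - 1)"
    using assms simple by (intro sum_mono2) (auto simp: simple_graph_def)
  then show ?thesis using degree_le_fibre assms sum_fibres
    by (fastforce dest: degree_le_fibre)
qed

text \<open>A fibre of size k has degree sum at most k (k - 1), and k is at most
  \<open>m + 1\<close>. Replacing the first factor by \<open>m + 1\<close> makes the bound linear in
  k - 1, so \<open>sum_fibres\<close> applies.\<close>

lemma card_edges_le: "2 * card E \<le> (m + 1) * m"
proof -
  have fin: "finite V" using simple by (simp add: simple_graph_def)
  have "2 * card E = (\<Sum>v\<in>V. degree E v)" by (rule handshake[OF simple])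
  also have "\<dots> = (\<Sum>y\<in>h ` V. \<Sum>v\<in>fibre y. degree E v)"
    using sum.image_gen[OF fin] by (simp add: fibre_def)
  also have "\<dots> \<le> (\<Sum>y\<in>h ` V. (m + 1) * (card (fibre y) - 1))"
  proof (rule sum_mono)
    fix y assume y: "y \<in> h ` V"
    have "(\<Sum>v\<in>fibre y. degree E v) \<le> (\<Sum>v\<in>fibre y. card (fibre y) - 1)"
      using degree_le_fibre by (intro sum_mono) (auto simp: fibre_def)
    also have "\<dots> = card (fibre y) * (card (fibre y) - 1)" by simp
    also have "\<dots> \<le> (m + 1) * (card (fibre y) - 1)"
    proof (rule mult_right_mono)
      have "card (fibre y) - 1 \<le> (\<Sum>y\<in>h ` V. card (fibre y) - 1)"
        using y fin by (intro member_le_sum) auto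
      then show "card (fibre y) \<le> m + 1" using sum_fibres by linarith
    qed simp
    finally show "(\<Sum>v\<in>fibre y. degree E v) \<le> (m + 1) * (card (fibre y) - 1)" .
  qed
  also have "\<dots> = (m + 1) * (\<Sum>y\<in>h ` V. card (fibre y) - 1)" by (rule sum_distrib_left[symmetric])
  also have "\<dots> \<le> (m + 1) * m" using sum_fibres by (intro mult_left_mono) auto
  finally show ?thesis .
qed

end

section \<open>Real inequalities for the weight of an edge\<close>

text \<open>The point (x + s, x + t) lies in the triangle with corners (x + r, x), (x, x + r) and
  (x, x). The norm is convex and agrees at the first two corners, so it is bounded by interpolating
  between the corner values.\<close>

lemma sqrt_sum_squares_le_interpolation:
  fixes x s t r :: real
  assumes "0 \<le> x" "0 \<le> s" "0 \<le> t" "s + t \<le> r"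
  shows "sqrt ((x + s)\<^sup>2 + (x + t)\<^sup>2)
    \<le> sqrt 2 * x + (s + t) * ((sqrt ((x + r)\<^sup>2 + x\<^sup>2) - sqrt 2 * x) / r)"
proof (cases "r = 0")
  case True
  then have "s = 0" "t = 0" using assms by auto
  then show ?thesis using assms by (simp add: real_sqrt_mult)
next
  case False
  then have r: "r > 0" using assms by linarith
  have scale: "sqrt ((c * p)\<^sup>2 + (c * q)\<^sup>2) = c * sqrt (p\<^sup>2 + q\<^sup>2)" if "c \<ge> 0" for c p q :: real
    using that by (simp add: power_mult_distrib real_sqrt_mult flip: distrib_left)
  \<comment> \<open>\<open>l\<close>, \<open>k\<close> and \<open>j\<close> are the barycentric
    coordinates in that triangle.\<close>
  define l where "l = s / r"
  define k where "k = t / r"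
  define j where "j = 1 - l - k"
  have nn: "l \<ge> 0" "k \<ge> 0" using assms r by (auto simp: l_def k_def)
  have "(s + t) / r \<le> 1" using assms r by simp
  then have jn: "j \<ge> 0" by (simp add: j_def l_def k_def add_divide_distrib)
  have lr: "l * r = s" "k * r = t" using r by (auto simp: l_def k_def)
  have e1: "x + s = l * (x + r) + (k * x + j * x)"
    and e2: "x + t = l * x + (k * (x + r) + j * x)"
    by (simp_all add: j_def algebra_simps lr)
  have "sqrt ((x + s)\<^sup>2 + (x + t)\<^sup>2)
      \<le> sqrt ((l * (x + r))\<^sup>2 + (l * x)\<^sup>2) + sqrt ((k * x + j * x)\<^sup>2 + (k * (x + r) + j * x)\<^sup>2)"
    unfolding e1 e2 by (rule real_sqrt_sum_squares_triangle_ineq)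
  also have "sqrt ((k * x + j * x)\<^sup>2 + (k * (x + r) + j * x)\<^sup>2)
      \<le> sqrt ((k * x)\<^sup>2 + (k * (x + r))\<^sup>2) + sqrt ((j * x)\<^sup>2 + (j * x)\<^sup>2)"
    by (rule real_sqrt_sum_squares_triangle_ineq)
  finally have "sqrt ((x + s)\<^sup>2 + (x + t)\<^sup>2)
      \<le> l * sqrt ((x + r)\<^sup>2 + x\<^sup>2) + (k * sqrt (x\<^sup>2 + (x + r)\<^sup>2) + j * sqrt (x\<^sup>2 + x\<^sup>2))"
    unfolding scale[OF nn(1)] scale[OF nn(2)] scale[OF jn] by simp
  also have "sqrt (x\<^sup>2 + x\<^sup>2) = sqrt 2 * x"
    using assms real_sqrt_mult[of 2 "x\<^sup>2"] by (simp flip: mult_2)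
  also have "l * sqrt ((x + r)\<^sup>2 + x\<^sup>2) + (k * sqrt (x\<^sup>2 + (x + r)\<^sup>2) + j * (sqrt 2 * x))
      = sqrt 2 * x + (l + k) * (sqrt ((x + r)\<^sup>2 + x\<^sup>2) - sqrt 2 * x)"
    by (simp add: j_def algebra_simps)
  also have "(l + k) * (sqrt ((x + r)\<^sup>2 + x\<^sup>2) - sqrt 2 * x)
      = (s + t) * ((sqrt ((x + r)\<^sup>2 + x\<^sup>2) - sqrt 2 * x) / r)"
    by (simp add: l_def k_def add_divide_distrib[symmetric])
  finally show ?thesis .
qed

text \<open>Replacing (p, q) by (p + q - 1, 1) raises the sum of squares by 2 (p - 1) (q - 1); then
  p + q is raised to n. Equality makes both gains zero.\<close>

lemma sum_squares_le_extreme: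
  fixes p q :: real
  assumes "1 \<le> p" "1 \<le> q" "p + q \<le> n"
  shows "p\<^sup>2 + q\<^sup>2 \<le> (n - 1)\<^sup>2 + 1"
    and "p\<^sup>2 + q\<^sup>2 = (n - 1)\<^sup>2 + 1 \<Longrightarrow> p + q = n \<and> (p = 1 \<or> q = 1)"
proof -
  have id: "(p + q - 1)\<^sup>2 + 1 - (p\<^sup>2 + q\<^sup>2) = 2 * ((p - 1) * (q - 1))"
    by (simp add: power2_eq_square algebra_simps)
  have pr: "0 \<le> (p - 1) * (q - 1)" using assms by simp
  have sq: "(p + q - 1)\<^sup>2 \<le> (n - 1)\<^sup>2" using assms by (intro power_mono) auto
  show "p\<^sup>2 + q\<^sup>2 \<le> (n - 1)\<^sup>2 + 1" using id pr sq by linarith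
  assume eq: "p\<^sup>2 + q\<^sup>2 = (n - 1)\<^sup>2 + 1"
  then have "(p - 1) * (q - 1) = 0" "(p + q - 1)\<^sup>2 = (n - 1)\<^sup>2" using id pr sq by linarith+
  moreover from this(2) have "p + q - 1 = n - 1"
    using assms by (subst (asm) power2_eq_iff_nonneg) auto
  ultimately show "p + q = n \<and> (p = 1 \<or> q = 1)" by auto
qed

text \<open>The Sombor index of a clique on x + 1 vertices with r pendent edges at one vertex. The
  middle term gives every clique edge weight \<open>sqrt 2 * x\<close>; the last one corrects the x
  clique edges at that vertex.\<close>

definition max_sombor :: "real \<Rightarrow> real \<Rightarrow> real" where
  "max_sombor x r = r * sqrt ((x + r)\<^sup>2 + 1) + (x + 1) * x / 2 * (sqrt 2 * x)
    + x * (sqrt ((x + r)\<^sup>2 + x\<^sup>2) - sqrt 2 * x)"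

section \<open>The upper bound for a connected graph and its equality conditions\<close>

locale simple_connected_graph =
  fixes V :: "'a set" and E :: "'a set set"
  assumes simple: "simple_graph V E" and connected: "connected_graph V E"
begin

definition B :: "'a set set" where "B = {e \<in> E. cut_edge V E e}"

definition m :: nat where "m = card V - card B - 1"

lemma finite_V: "finite V" and finite_E: "finite E" and finite_B: "finite B" and B_subset: "B \<subseteq> E"
  using simple_graph_finite[OF simple] by (auto simp: B_def)

lemma cut_edge_ends:
  assumes "{a, b} \<in> B"
  shows "a \<noteq> b \<and> a \<in> V \<and> b \<in> V"
proof -
  have "{a, b} \<subseteq> V \<and> card {a, b} = 2"
    using assms simple B_subset unfolding simple_graph_def by blast
  then show ?thesis by (cases "a = b") auto
qed

lemma cut_edge_not_reach: "{a, b} \<in> B \<Longrightarrow> \<not> (adj (E - {{a, b}}))\<^sup>*\<^sup>* a b"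
  using cut_edge_separates[OF connected] by (auto simp: B_def)

lemma cut_edges_less: "card B + 1 \<le> card (component V (E - B) ` V)"
  using card_components_remove_cut_edges[OF simple connected finite_B] by (simp add: B_def)

text \<open>There are at most as many components as vertices, so the subtraction in \<open>m\<close>
  does not truncate.\<close>

lemma card_V: "card V = m + card B + 1"
proof -
  have "card (component V (E - B) ` V) \<le> card V" by (rule card_image_le[OF finite_V])
  then show ?thesis using cut_edges_less by (simp add: m_def)
qed

text \<open>Vertices are labelled by their component after all cut edges are deleted; there are at
  least \<open>card B + 1\<close> labels.\<close>

sublocale noncut: edge_constant_labelling V "E - B" "component V (E - B)" m
proof
  show "simple_graph V (E - B)" using simple by (rule simple_graph_subset) auto
next
  fix u v assume uv: "{u, v} \<in> E - B"
  then have "u \<in> V" "v \<in> V" using simple by (auto simp: simple_graph_def)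
  then show "component V (E - B) u = component V (E - B) v"
    using uv by (auto simp: component_eq_iff adj_def)
next
  show "card V \<le> m + card (component V (E - B) ` V)" using card_V cut_edges_less by simp
qed

text \<open>The neighbourhoods of the ends are disjoint, since a common neighbour would give a path
  of length two around the cut edge.\<close>

lemma cut_edge_degree_add_le:
  assumes "{a, b} \<in> B"
  shows "degree E a + degree E b \<le> card V"
proof -
  let ?N = "\<lambda>v. {w. {v, w} \<in> E}"
  have ne: "a \<noteq> b" using assms cut_edge_ends by blast
  have sub: "?N v \<subseteq> V" for v using neighbours_subset[OF simple, of v] by auto
  have "?N a \<inter> ?N b = {}"
  proof (rule ccontr)
    assume "?N a \<inter> ?N b \<noteq> {}"
    then obtain w where w: "{a, w} \<in> E" "{b, w} \<in> E" by auto
    then have "w \<noteq> a" "w \<noteq> b" using neighbours_subset[OF simple] by auto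
    then have "adj (E - {{a, b}}) a w" "adj (E - {{a, b}}) w b"
      using w ne by (auto simp: adj_def doubleton_eq_iff insert_commute[of w b])
    then have "(adj (E - {{a, b}}))\<^sup>*\<^sup>* a b" by (meson converse_rtranclp_into_rtranclp rtranclp.rtrancl_refl)
    then show False using cut_edge_not_reach[OF assms] by simp
  qed
  then have "card (?N a) + card (?N b) = card (?N a \<union> ?N b)"
    using sub finite_V by (metis card_Un_disjoint finite_subset)
  also have "\<dots> \<le> card V" using sub finite_V by (intro card_mono) auto
  finally show ?thesis by (simp add: degree_eq_card_neighbours[OF simple])
qed

lemma degree_ge_1: "e \<in> E \<Longrightarrow> v \<in> e \<Longrightarrow> 1 \<le> degree E v"
  using finite_E by (auto simp: degree_def Suc_le_eq card_gt_0_iff)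

lemma degree_1_unique_edge:
  assumes "degree E v = 1" "e \<in> E" "e' \<in> E" "v \<in> e" "v \<in> e'"
  shows "e = e'"
proof -
  obtain f where f: "{e \<in> E. v \<in> e} = {f}" using assms(1) unfolding degree_def by (rule card_1_singletonE)
  have "e \<in> {f}" "e' \<in> {f}" using assms unfolding f[symmetric] by simp_all
  then show ?thesis by simp
qed

definition weight :: "'a set \<Rightarrow> real" where
  "weight e = sqrt (\<Sum>v\<in>e. (real (degree E v))\<^sup>2)"

lemma weight_doubleton: "a \<noteq> b \<Longrightarrow> weight {a, b} = sqrt ((real (degree E a))\<^sup>2 + (real (degree E b))\<^sup>2)"
  by (simp add: weight_def)

text \<open>Both facts are \<open>sum_squares_le_extreme\<close> for the two end degrees with n =
  \<open>card V\<close>; the second one recovers a leaf and a vertex adjacent to all others.\<close>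

lemma
  assumes "e \<in> B"
  shows weight_cut_edge_le: "weight e \<le> sqrt ((real m + real (card B))\<^sup>2 + 1)"
    and weight_cut_edge_eqD: "weight e = sqrt ((real m + real (card B))\<^sup>2 + 1) \<Longrightarrow>
      \<exists>a b. e = {a, b} \<and> a \<noteq> b \<and> degree E b = 1 \<and> degree E a = card V - 1"
proof -
  obtain a b where e: "e = {a, b}" "a \<noteq> b"
    using assms B_subset simple_graphE[OF simple] by blast
  have "1 \<le> degree E a" "1 \<le> degree E b" using e assms degree_ge_1 B_subset by auto
  then have d: "1 \<le> real (degree E a)" "1 \<le> real (degree E b)" by simp_all
  have "degree E a + degree E b \<le> card V" using cut_edge_degree_add_le assms e by blast
  then have dd: "real (degree E a) + real (degree E b) \<le> real (card V)" by linarith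
  have V1: "real (card V) - 1 = real m + real (card B)" using card_V by simp
  note extreme = sum_squares_le_extreme[OF d dd, unfolded V1]
  have w: "weight e = sqrt ((real (degree E a))\<^sup>2 + (real (degree E b))\<^sup>2)"
    using e weight_doubleton by simp
  show "weight e \<le> sqrt ((real m + real (card B))\<^sup>2 + 1)"
    unfolding w using extreme(1) by simp
  assume "weight e = sqrt ((real m + real (card B))\<^sup>2 + 1)"
  then have "real (degree E a) + real (degree E b) = real (card V)
      \<and> (real (degree E a) = 1 \<or> real (degree E b) = 1)"
    using extreme(2) unfolding w by simp
  then have "degree E b = 1 \<and> degree E a = card V - 1 \<or> degree E a = 1 \<and> degree E b = card V - 1"
    by auto
  then show "\<exists>a b. e = {a, b} \<and> a \<noteq> b \<and> degree E b = 1 \<and> degree E a = card V - 1"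
    using e by (metis insert_commute)
qed

text \<open>Slope of the chord of the Euclidean norm between (m, m) and (m + card B, m), as in the
  interpolation lemma. Without cut edges, division by zero makes it 0.\<close>

definition slope :: real where
  "slope = (sqrt ((real m + real (card B))\<^sup>2 + (real m)\<^sup>2) - sqrt 2 * real m) / real (card B)"

lemma slope_nonneg: "0 \<le> slope"
proof -
  have "sqrt 2 * real m = sqrt ((real m)\<^sup>2 + (real m)\<^sup>2)"
    using real_sqrt_mult[of 2 "(real m)\<^sup>2"] by (simp flip: mult_2)
  also have "\<dots> \<le> sqrt ((real m + real (card B))\<^sup>2 + (real m)\<^sup>2)"
    by (auto intro!: power_mono)
  finally show ?thesis by (simp add: slope_def)
qed

text \<open>The degree of an end is at most \<open>m\<close> plus the number of cut edges there. No
  cut edge contains both ends, so these numbers add up to at most \<open>card B\<close> and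
  interpolation applies.\<close>

lemma weight_noncut_edge_le:
  assumes "e \<in> E - B"
  shows "weight e \<le> sqrt 2 * real m + real (\<Sum>v\<in>e. degree B v) * slope"
proof -
  obtain u v where e: "e = {u, v}" "u \<noteq> v" "u \<in> V" "v \<in> V"
    using assms simple_graphE[OF simple] by blast
  have d: "degree E w \<le> m + degree B w" if "w \<in> V" for w
    using degree_split[OF finite_E B_subset] noncut.degree_le[OF that] by simp
  have "{e \<in> B. u \<in> e} \<inter> {e \<in> B. v \<in> e} = {}"
  proof (rule ccontr)
    assume "{e \<in> B. u \<in> e} \<inter> {e \<in> B. v \<in> e} \<noteq> {}"
    then obtain f where f: "f \<in> B" "u \<in> f" "v \<in> f" by auto
    then obtain a b where "f = {a, b}" using simple_graphE[OF simple] B_subset by blast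
    then have "f = e" using f e by auto
    then show False using f assms by simp
  qed
  then have "degree B u + degree B v = card ({e \<in> B. u \<in> e} \<union> {e \<in> B. v \<in> e})"
    unfolding degree_def using finite_B by (subst card_Un_disjoint) auto
  also have "\<dots> \<le> card B" using finite_B by (intro card_mono) auto
  finally have b: "real (degree B u) + real (degree B v) \<le> real (card B)" by linarith
  have "weight e = sqrt ((real (degree E u))\<^sup>2 + (real (degree E v))\<^sup>2)"
    using e weight_doubleton by simp
  also have "\<dots> \<le> sqrt ((real m + real (degree B u))\<^sup>2 + (real m + real (degree B v))\<^sup>2)"
    using d[OF e(3)] d[OF e(4)] by (intro real_sqrt_le_mono add_mono power_mono) linarith+
  also have "\<dots> \<le> sqrt 2 * real m + (real (degree B u) + real (degree B v)) * slope"
    unfolding slope_def by (rule sqrt_sum_squares_le_interpolation) (use b in auto)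
  finally show ?thesis using e by simp
qed

text \<open>Double counting trades the cut-degrees of the ends of non-cut edges for the
  non-cut degrees of the ends of cut edges, which lie in different components.\<close>

lemma sum_cut_degrees_le: "(\<Sum>e\<in>E - B. \<Sum>v\<in>e. degree B v) \<le> card B * m"
proof -
  have "(\<Sum>e\<in>E - B. \<Sum>v\<in>e. degree B v) = (\<Sum>v\<in>V. degree (E - B) v * degree B v)"
    by (rule sum_over_edge_ends[OF noncut.simple])
  also have "\<dots> = (\<Sum>v\<in>V. degree B v * degree (E - B) v)" by (simp add: mult.commute)
  also have "\<dots> = (\<Sum>e\<in>B. \<Sum>v\<in>e. degree (E - B) v)"
    using sum_over_edge_ends[OF simple_graph_subset[OF simple B_subset]] by simp
  also have "\<dots> \<le> (\<Sum>e\<in>B. m)"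
  proof (rule sum_mono)
    fix e assume e: "e \<in> B"
    then obtain a b where ab: "e = {a, b}" "a \<noteq> b" "a \<in> V" "b \<in> V"
      using B_subset simple_graphE[OF simple] by blast
    have "\<not> (adj (E - B))\<^sup>*\<^sup>* a b"
      using cut_edge_not_reach reach_mono[of "E - B" "E - {{a, b}}"] e ab by blast
    then show "(\<Sum>v\<in>e. degree (E - B) v) \<le> m"
      using ab noncut.degree_add_le[OF ab(3,4)] by (simp add: component_eq_iff)
  qed
  finally show ?thesis by simp
qed

lemma sum_noncut_weights_le:
  "sum weight (E - B) \<le> real (card (E - B)) * (sqrt 2 * real m)
    + real m * (sqrt ((real m + real (card B))\<^sup>2 + (real m)\<^sup>2) - sqrt 2 * real m)"
proof -
  have "sum weight (E - B) \<le> (\<Sum>e\<in>E - B. sqrt 2 * real m + real (\<Sum>v\<in>e. degree B v) * slope)"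
    by (intro sum_mono weight_noncut_edge_le)
  also have "\<dots> = real (card (E - B)) * (sqrt 2 * real m)
      + real (\<Sum>e\<in>E - B. \<Sum>v\<in>e. degree B v) * slope"
    by (simp add: sum.distrib sum_distrib_right)
  also have "real (\<Sum>e\<in>E - B. \<Sum>v\<in>e. degree B v) * slope \<le> real (card B * m) * slope"
    using sum_cut_degrees_le slope_nonneg by (intro mult_right_mono) (auto simp only: of_nat_le_iff)
  also have "\<dots> = real m * (sqrt ((real m + real (card B))\<^sup>2 + (real m)\<^sup>2) - sqrt 2 * real m)"
  proof (cases "card B = 0")
    \<comment> \<open>The left side has the factor \<open>card B\<close>, which is 0, and the
      bracket on the right vanishes as well.\<close>
    case True
    have "sqrt ((real m)\<^sup>2 + (real m)\<^sup>2) = sqrt 2 * real m"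
      using real_sqrt_mult[of 2 "(real m)\<^sup>2"] by (simp flip: mult_2)
    then show ?thesis using True by (simp only: slope_def) simp
  qed (simp add: slope_def)
  finally show ?thesis by simp
qed

text \<open>The number of non-cut edges and the total weight of the cut edges each have an upper
  bound, and the Sombor index reaches the value where both are tight. Positivity of \<open>m\<close>
  allows cancelling \<open>sqrt 2 * real m\<close> to recover the edge count.\<close>

lemma max_sombor_attained:
  assumes "0 < m" "max_sombor (real m) (real (card B)) \<le> sombor E"
  shows "2 * card (E - B) = (m + 1) * m"
    and "e \<in> B \<Longrightarrow> weight e = sqrt ((real m + real (card B))\<^sup>2 + 1)"
proof -
  let ?T = "sqrt ((real m + real (card B))\<^sup>2 + 1)"
  have split: "sombor E = sum weight B + sum weight (E - B)"
    using sum.subset_diff[OF B_subset finite_E, of weight]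
    by (simp add: sombor_def weight_def add.commute)
  have cut: "sum weight B \<le> (\<Sum>e\<in>B. ?T)" by (intro sum_mono weight_cut_edge_le)
  have c: "2 * card (E - B) \<le> (m + 1) * m" by (rule noncut.card_edges_le)
  have "real (2 * card (E - B)) \<le> real ((m + 1) * m)" using c by (simp only: of_nat_le_iff)
  then have c': "real (card (E - B)) \<le> (real m + 1) * real m / 2" by (simp add: algebra_simps)
  have pos: "0 < sqrt 2 * real m" using assms by simp
  have ge: "(real m + 1) * real m / 2 * (sqrt 2 * real m) + real (card B) * ?T
      \<le> real (card (E - B)) * (sqrt 2 * real m) + sum weight B"
    using assms(2) split sum_noncut_weights_le unfolding max_sombor_def by linarith
  have "real (card (E - B)) * (sqrt 2 * real m) \<le> (real m + 1) * real m / 2 * (sqrt 2 * real m)"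
    using c' pos by (intro mult_right_mono) auto
  moreover have TB: "(\<Sum>e\<in>B. ?T) = real (card B) * ?T" by simp
  ultimately have "sum weight B = (\<Sum>e\<in>B. ?T)" using ge cut by linarith
  then show "e \<in> B \<Longrightarrow> weight e = ?T"
    using sum_mono_inv[of weight B "\<lambda>_. ?T"] weight_cut_edge_le finite_B by blast
  have "(real m + 1) * real m / 2 * (sqrt 2 * real m) \<le> real (card (E - B)) * (sqrt 2 * real m)"
    using ge cut TB by linarith
  then have "(real m + 1) * real m / 2 \<le> real (card (E - B))"
    using pos by (simp only: mult_le_cancel_right_pos)
  then have "real ((m + 1) * m) \<le> real (2 * card (E - B))" by (simp add: algebra_simps)
  then have "(m + 1) * m \<le> 2 * card (E - B)" by (simp only: of_nat_le_iff)
  then show "2 * card (E - B) = (m + 1) * m" using c by simp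
qed

end

section \<open>Cliques with pendent edges, and the structure forced by equality\<close>

text \<open>The target graph on an arbitrary vertex set, with leaves \<open>P\<close> and centre
  \<open>a\<close>, so that it can also serve as a competitor over the vertex type of the given
  graph.\<close>

definition pendent_clique :: "'a set \<Rightarrow> 'a set \<Rightarrow> 'a \<Rightarrow> 'a set set" where
  "pendent_clique V P a = {e. e \<subseteq> V - P \<and> card e = 2} \<union> (\<lambda>x. {a, x}) ` P"

lemma inj_doubleton: "a \<notin> P \<Longrightarrow> inj_on (\<lambda>x. {a, x}) P"
  by (auto simp: inj_on_def doubleton_eq_iff)

lemma twice_card_pairs:
  assumes "finite W"
  shows "2 * card {e. e \<subseteq> W \<and> card e = 2} = card W * (card W - 1)"
proof -
  have "even (card W * (card W - 1))" by (cases "card W") auto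
  then show ?thesis using n_subsets[OF assms, of 2] by (simp add: choose_two)
qed

lemma (in simple_connected_graph) extremal_structure:
  assumes "2 \<le> m" "max_sombor (real m) (real (card B)) \<le> sombor E"
  shows "\<exists>P a. P \<subseteq> V \<and> a \<in> V - P \<and> card P = card B \<and> E = pendent_clique V P a"
proof -
  have m: "0 < m" using assms(1) by simp
  note attained = max_sombor_attained[OF m assms(2)]
  have "\<exists>P a. P \<subseteq> V \<and> a \<in> V - P \<and> B = (\<lambda>x. {a, x}) ` P \<and> (\<forall>e\<in>E - B. e \<inter> P = {})"
  proof (cases "B = {}")
    case True
    then show ?thesis using connected by (intro exI[of _ "{}"]) (auto simp: connected_graph_def)
  next
    case False
    then obtain e where e: "e \<in> B" by auto
    \<comment> \<open>One cut edge fixes the centre: its end \<open>a\<close> is adjacent to all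
      other vertices, so every leaf hangs at \<open>a\<close>.\<close>
    then obtain a b where ab: "{a, b} \<in> B" "a \<noteq> b" "degree E b = 1" "degree E a = card V - 1"
      using weight_cut_edge_eqD[OF e attained(2)[OF e]] e by blast
    have aV: "a \<in> V" using ab cut_edge_ends by blast
    \<comment> \<open>The degree of \<open>a\<close> is \<open>m + card B\<close>, hence at least 2,
      so \<open>a\<close> is not the leaf end of any cut edge.\<close>
    have deg_a: "degree E a \<noteq> 1" using ab assms(1) card_V by simp
    have "{w. {a, w} \<in> E} = V - {a}"
      using neighbours_subset[OF simple, of a] ab(4) finite_V aV
      by (intro card_subset_eq) (auto simp: degree_eq_card_neighbours[OF simple])
    then have nb: "{a, w} \<in> E" if "w \<in> V" "w \<noteq> a" for w using that by auto
    define P where "P = {x. {a, x} \<in> B}"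
    have leaf: "\<exists>x. e = {a, x} \<and> degree E x = 1" if e: "e \<in> B" for e
    proof -
      obtain c d where cd: "e = {c, d}" "c \<noteq> d" "degree E d = 1"
        using weight_cut_edge_eqD[OF e attained(2)[OF e]] by blast
      have "d \<in> V" "d \<noteq> a" using cd deg_a e cut_edge_ends by blast+
      then have "{c, d} = {a, d}"
        using degree_1_unique_edge[of d "{c, d}" "{a, d}"] cd(3) nb e cd B_subset by auto
      then show ?thesis using cd by metis
    qed
    have "B = (\<lambda>x. {a, x}) ` P" using leaf by (auto simp: P_def image_iff)
    moreover have "P \<subseteq> V" using cut_edge_ends by (auto simp: P_def)
    moreover have "a \<notin> P" using cut_edge_ends[of a a] by (auto simp: P_def)
    \<comment> \<open>A vertex of \<open>P\<close> has degree 1, and its only edge is already a cut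
      edge.\<close>
    moreover have "e \<inter> P = {}" if "e \<in> E - B" for e
    proof (rule ccontr)
      assume "e \<inter> P \<noteq> {}"
      then obtain x where x: "x \<in> e" "{a, x} \<in> B" by (auto simp: P_def)
      then have "x \<noteq> a" using cut_edge_ends by blast
      then have "degree E x = 1" using leaf[OF x(2)] doubleton_eq_iff[of a x a] by auto
      then have "e = {a, x}" using degree_1_unique_edge[of x e "{a, x}"] x that B_subset by auto
      then show False using x that by simp
    qed
    ultimately show ?thesis using aV by (intro exI[of _ P] exI[of _ a] conjI ballI) auto
  qed
  then obtain P a where P: "P \<subseteq> V" "a \<in> V - P" "B = (\<lambda>x. {a, x}) ` P"
    and disj: "\<forall>e\<in>E - B. e \<inter> P = {}" by (elim exE conjE)
  have card_P: "card P = card B" using P inj_doubleton[of a P] by (simp add: card_image)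
  have fin: "finite (V - P)" "finite P" using finite_V P by (auto intro: finite_subset)
  have "card (V - P) = m + 1" using card_V card_P fin P by (simp add: card_Diff_subset)
  \<comment> \<open>The non-cut edges are pairs inside \<open>V - P\<close> and are as many as all
    such pairs, so they form the whole clique.\<close>
  then have "card {e. e \<subseteq> V - P \<and> card e = 2} = card (E - B)"
    using twice_card_pairs[OF fin(1)] attained(1) by simp
  moreover have "E - B \<subseteq> {e. e \<subseteq> V - P \<and> card e = 2}"
    using disj simple by (auto simp: simple_graph_def)
  ultimately have "E - B = {e. e \<subseteq> V - P \<and> card e = 2}"
    using fin by (intro card_subset_eq) auto
  then have "E = pendent_clique V P a"
    using P(3) B_subset by (auto simp: pendent_clique_def)
  then show ?thesis using P card_P by blast
qed

section \<open>Cut edges, degrees and Sombor index of the extremal graph\<close>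

text \<open>With at least three clique vertices every clique edge lies in a triangle, so it is not a
  cut edge.\<close>

locale pendent_clique_graph =
  fixes V P :: "'a set" and a :: 'a
  assumes finite_V: "finite V" and P: "P \<subseteq> V" and a: "a \<in> V - P" and large: "3 \<le> card (V - P)"
begin

abbreviation "G \<equiv> pendent_clique V P a"
abbreviation "K \<equiv> {e. e \<subseteq> V - P \<and> card e = 2}"

lemma finite_P: "finite P" using P finite_V finite_subset by blast

lemma simple: "simple_graph V G"
  using finite_V P a by (auto simp: simple_graph_def pendent_clique_def card_2_iff)

lemma clique_edge: "u \<in> V - P \<Longrightarrow> v \<in> V - P \<Longrightarrow> u \<noteq> v \<Longrightarrow> {u, v} \<in> G"
  by (auto simp: pendent_clique_def)

lemma pendent_edge: "x \<in> P \<Longrightarrow> {a, x} \<in> G"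
  by (auto simp: pendent_clique_def)

text \<open>The centre is joined directly to every other vertex. Only the deletion of a clique edge
  at \<open>a\<close> requires a detour, through a third clique vertex.\<close>

lemma reach_clique:
  assumes "e \<notin> (\<lambda>x. {a, x}) ` P" "v \<in> V"
  shows "(adj (G - {e}))\<^sup>*\<^sup>* a v"
proof -
  consider "v = a" | "v \<in> P" | "v \<in> V - P" "v \<noteq> a" "e \<noteq> {a, v}" | "v \<in> V - P" "v \<noteq> a" "e = {a, v}"
    using assms by blast
  then show ?thesis
  proof cases
    case 2
    then have "adj (G - {e}) a v" using assms pendent_edge by (auto simp: adj_def)
    then show ?thesis by simp
  next
    case 3
    then have "adj (G - {e}) a v" using clique_edge[of a v] a by (auto simp: adj_def)
    then show ?thesis by simp
  next
    case 4
    have "\<not> V - P \<subseteq> {a, v}"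
    proof
      assume "V - P \<subseteq> {a, v}"
      then have "card (V - P) \<le> card {a, v}" by (intro card_mono) auto
      also have "\<dots> \<le> 2" by (simp add: card_insert_if)
      finally show False using large by simp
    qed
    then obtain w where w: "w \<in> V - P" "w \<noteq> a" "w \<noteq> v" by auto
    then have "adj (G - {e}) a w" "adj (G - {e}) w v"
      using 4 a clique_edge[of a w] clique_edge[of w v] by (auto simp: adj_def doubleton_eq_iff)
    then show ?thesis by (meson converse_rtranclp_into_rtranclp r_into_rtranclp)
  qed simp
qed

lemma connected: "connected_graph V G"
proof (rule connected_graphI)
  show "a \<in> V" using a by simp
  fix v assume "v \<in> V"
  \<comment> \<open>The empty set is no edge, so deleting it turns \<open>reach_clique\<close> into
    connectedness of \<open>G\<close> itself.\<close>
  moreover have "{} \<notin> (\<lambda>x. {a, x}) ` P" by auto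
  ultimately show "(adj G)\<^sup>*\<^sup>* a v"
    using reach_clique[of "{}" v] reach_mono[of "G - {{}}" G] by blast
qed

lemma pendent_edge_unique:
  assumes "x \<in> P" "e \<in> G" "x \<in> e"
  shows "e = {a, x}"
  using assms a by (auto simp: pendent_clique_def)

text \<open>Deleting a pendent edge isolates its leaf; deleting any other edge leaves all vertices
  reachable from \<open>a\<close>.\<close>

lemma cut_edges: "{e \<in> G. cut_edge V G e} = (\<lambda>x. {a, x}) ` P"
proof (intro equalityI subsetI)
  fix e assume "e \<in> {e \<in> G. cut_edge V G e}"
  then have "\<not> connected_graph V (G - {e})" by (simp add: cut_edge_def)
  then show "e \<in> (\<lambda>x. {a, x}) ` P"
    using connected_graphI[of a V "G - {e}"] reach_clique[of e] a by blast
next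
  fix e assume "e \<in> (\<lambda>x. {a, x}) ` P"
  then obtain x where x: "x \<in> P" "e = {a, x}" by auto
  have "\<not> adj (G - {e}) x y" for y
    using pendent_edge_unique[OF x(1), of "{x, y}"] x by (auto simp: adj_def)
  moreover have "x \<noteq> a" using x a by auto
  ultimately have "\<not> (adj (G - {e}))\<^sup>*\<^sup>* x a" by (meson converse_rtranclpE)
  then have "\<not> connected_graph V (G - {e})"
    using x P a by (auto simp: connected_graph_def)
  then show "e \<in> {e \<in> G. cut_edge V G e}"
    using x pendent_edge by (auto simp: cut_edge_def)
qed

lemma num_cut_edges: "num_cut_edges V G = card P"
  unfolding num_cut_edges_def cut_edges using a by (intro card_image inj_doubleton) simp

lemma degree_center: "degree G a = card V - 1"
proof -
  have "{w. {a, w} \<in> G} = V - {a}"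
    using neighbours_subset[OF simple, of a] pendent_edge clique_edge a by blast
  then show ?thesis using degree_eq_card_neighbours[OF simple] a by simp
qed

lemma degree_pendent:
  assumes "x \<in> P" shows "degree G x = 1"
proof -
  have "{e \<in> G. x \<in> e} \<subseteq> {{a, x}}"
    using pendent_edge_unique[OF assms] by (simp add: subset_iff)
  moreover have "{a, x} \<in> {e \<in> G. x \<in> e}" using pendent_edge[OF assms] by simp
  ultimately have "{e \<in> G. x \<in> e} = {{a, x}}" by (intro equalityI) simp_all
  then show ?thesis by (simp add: degree_def)
qed

lemma degree_clique:
  assumes "u \<in> V - P" "u \<noteq> a" shows "degree G u = card (V - P) - 1"
proof -
  have "{w. {u, w} \<in> G} = V - P - {u}"
  proof (intro equalityI subsetI)
    fix w assume "w \<in> {w. {u, w} \<in> G}"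
    then have w: "{u, w} \<in> G" by simp
    then have "w \<in> V - {u}" using neighbours_subset[OF simple, of u] by auto
    moreover have "w \<notin> P" using pendent_edge_unique[of w, OF _ w] assms by (auto simp: doubleton_eq_iff)
    ultimately show "w \<in> V - P - {u}" by simp
  next
    fix w assume "w \<in> V - P - {u}"
    then show "w \<in> {w. {u, w} \<in> G}" using clique_edge[OF assms(1), of w] by auto
  qed
  then show ?thesis using degree_eq_card_neighbours[OF simple] assms by simp
qed

lemma sombor_eq:
  "sombor G = max_sombor (real (card (V - P) - 1)) (real (card P))"
proof -
  define x where "x = real (card (V - P) - 1)"
  define r where "r = real (card P)"
  let ?w = "\<lambda>e. sqrt (\<Sum>v\<in>e. (real (degree G v))\<^sup>2)"
  let ?A = "sqrt ((x + r)\<^sup>2 + x\<^sup>2)"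
  have "card V = card (V - P) + card P"
    using finite_V P finite_P by (simp add: card_Diff_subset card_mono)
  then have da: "real (degree G a) = x + r"
    using large by (simp add: degree_center x_def r_def)
  have du: "real (degree G u) = x" if "u \<in> V - P" "u \<noteq> a" for u
    using degree_clique[OF that] by (simp add: x_def)
  have finK: "finite K" using finite_V by auto
  have simpleK: "simple_graph (V - P) K" using finite_V by (auto simp: simple_graph_def)
  have disj: "K \<inter> (\<lambda>x. {a, x}) ` P = {}" by auto
  have "sombor G = sum ?w K + sum ?w ((\<lambda>x. {a, x}) ` P)"
    unfolding sombor_def pendent_clique_def[of V P a, symmetric]
    using sum.union_disjoint[OF finK _ disj, of ?w] finite_P by (simp add: pendent_clique_def)
  also have "sum ?w ((\<lambda>x. {a, x}) ` P) = (\<Sum>y\<in>P. ?w {a, y})"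
    using inj_doubleton[of a P] a by (simp add: sum.reindex)
  also have "\<dots> = (\<Sum>y\<in>P. sqrt ((x + r)\<^sup>2 + 1))"
  proof (rule sum.cong)
    fix y assume y: "y \<in> P"
    then have "y \<noteq> a" using a by auto
    then show "?w {a, y} = sqrt ((x + r)\<^sup>2 + 1)" using da degree_pendent[OF y] by simp
  qed simp
  \<comment> \<open>Clique edges get a common base weight plus a surcharge at the centre, to match
    the shape of \<open>max_sombor\<close>.\<close>
  also have "sum ?w K = (\<Sum>e\<in>K. sqrt 2 * x + (if a \<in> e then ?A - sqrt 2 * x else 0))"
  proof (rule sum.cong)
    fix e assume "e \<in> K"
    then obtain u v where e: "e = {u, v}" "u \<noteq> v" "u \<in> V - P" "v \<in> V - P"
      using simple_graphE[OF simpleK] by metis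
    have w: "?w e = sqrt ((real (degree G u))\<^sup>2 + (real (degree G v))\<^sup>2)"
      using e by simp
    have diag: "sqrt (x\<^sup>2 + x\<^sup>2) = sqrt 2 * x"
      using real_sqrt_mult[of 2 "x\<^sup>2"] by (simp add: x_def flip: mult_2)
    consider "u = a" "v \<noteq> a" | "v = a" "u \<noteq> a" | "u \<noteq> a" "v \<noteq> a" using e by auto
    then show "?w e = sqrt 2 * x + (if a \<in> e then ?A - sqrt 2 * x else 0)"
    proof cases
      case 1
      then show ?thesis unfolding w using da du[of v] e by simp
    next
      case 2
      then show ?thesis unfolding w using da du[of u] e by (simp add: add.commute)
    next
      case 3
      then show ?thesis unfolding w using du[of u] du[of v] e diag by simp
    qed
  qed simp
  also have "\<dots> = real (card K) * (sqrt 2 * x) + real (card {e \<in> K. a \<in> e}) * (?A - sqrt 2 * x)"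
    using finK by (simp add: sum.distrib sum.If_cases Int_def)
  also have "card {e \<in> K. a \<in> e} = card (V - P) - 1"
  proof -
    have "{w. {a, w} \<in> K} = V - P - {a}" using a by (auto simp: card_2_iff)
    then show ?thesis
      using degree_eq_card_neighbours[OF simpleK, of a] a by (simp add: degree_def)
  qed
  also have "real (card K) = (x + 1) * x / 2"
  proof -
    have "real (2 * card K) = real (card (V - P)) * x"
      unfolding x_def of_nat_mult[symmetric] using twice_card_pairs[of "V - P"] finite_V by simp
    also have "real (card (V - P)) = x + 1" using large by (simp add: x_def)
    finally show ?thesis by simp
  qed
  finally show ?thesis by (simp add: max_sombor_def x_def r_def)
qed

end

section \<open>Isomorphism with the concrete graph and the conclusion\<close>

lemma kpend_edges_eq: "r < n \<Longrightarrow> kpend_edges n r = pendent_clique {0..<n} {n - r..<n} 0"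
proof -
  assume r: "r < n"
  have "{0..<n} - {n - r..<n} = {0..<n - r}" by auto
  moreover have "{e. e \<subseteq> {0..<n - r} \<and> card e = 2} = {{i, j} | i j. i < j \<and> j < n - r}" (is "?L = ?R")
  proof (intro equalityI subsetI)
    fix e assume "e \<in> ?L"
    then obtain i j where ij: "e = {i, j}" "i \<noteq> j" "i < n - r" "j < n - r"
      by (auto simp: card_2_iff)
    then show "e \<in> ?R" by (cases i j rule: linorder_cases) (auto simp: insert_commute)
  qed auto
  ultimately show ?thesis by (auto simp: kpend_edges_def pendent_clique_def)
qed

lemma pendent_clique_iso:
  assumes "finite V" "P \<subseteq> V" "a \<in> V - P" "finite V'" "P' \<subseteq> V'" "a' \<in> V' - P'"
    and "card V = card V'" "card P = card P'"
  shows "graph_iso V (pendent_clique V P a) V' (pendent_clique V' P' a')"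
proof -
  have fin: "finite P" "finite P'" using assms finite_subset by blast+
  have "card (V - P - {a}) = card (V' - P' - {a'})"
    using assms fin by (simp add: card_Diff_subset)
  then obtain g where g: "bij_betw g (V - P - {a}) (V' - P' - {a'})"
    using assms finite_same_card_bij by (metis finite_Diff)
  obtain h where h: "bij_betw h P P'" using fin assms finite_same_card_bij by metis
  \<comment> \<open>Centre, leaves and remaining clique vertices are matched separately; equal
    cardinalities of the three classes provide the bijections.\<close>
  define f where "f v = (if v = a then a' else if v \<in> P then h v else g v)" for v
  have fa: "f a = a'" by (simp add: f_def)
  have fP: "bij_betw f P P'" using h assms(3) by (subst bij_betw_cong[where g = h]) (auto simp: f_def)
  have "bij_betw f (V - P - {a}) (V' - P' - {a'})"
    using g by (subst bij_betw_cong[where g = g]) (auto simp: f_def)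
  then have "bij_betw f ((V - P - {a}) \<union> {a}) ((V' - P' - {a'}) \<union> {a'})"
    by (rule bij_betw_combine) (auto simp: f_def bij_betw_def)
  moreover have "(V - P - {a}) \<union> {a} = V - P" "(V' - P' - {a'}) \<union> {a'} = V' - P'"
    using assms by auto
  ultimately have fW: "bij_betw f (V - P) (V' - P')" by simp
  have "bij_betw f ((V - P) \<union> P) ((V' - P') \<union> P')" using fW fP by (rule bij_betw_combine) auto
  moreover have "(V - P) \<union> P = V" "(V' - P') \<union> P' = V'" using assms by auto
  ultimately have bij: "bij_betw f V V'" by simp
  then have inj: "inj_on f V" by (simp add: bij_betw_def)
  have "e \<in> pendent_clique V P a \<longleftrightarrow> f ` e \<in> pendent_clique V' P' a'" if e: "e \<subseteq> V" for e
  proof -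
    have "card (f ` e) = card e" using inj e by (meson card_image inj_on_subset)
    moreover have "f ` e \<subseteq> V' - P' \<longleftrightarrow> e \<subseteq> V - P"
    proof -
      have "f ` e \<subseteq> V' - P' \<longleftrightarrow> f ` e \<subseteq> f ` (V - P)" using fW by (simp add: bij_betw_def)
      also have "\<dots> \<longleftrightarrow> (\<forall>x\<in>e. x \<in> V - P)"
        unfolding image_subset_iff using e by (intro ball_cong refl inj_on_image_mem_iff[OF inj]) auto
      also have "\<dots> \<longleftrightarrow> e \<subseteq> V - P" by blast
      finally show ?thesis .
    qed
    moreover have "f ` e \<in> (\<lambda>x. {a', x}) ` P' \<longleftrightarrow> e \<in> (\<lambda>x. {a, x}) ` P"
    proof -
      have "(\<lambda>x. {a', x}) ` P' = (\<lambda>x. {a', x}) ` f ` P" using fP by (simp add: bij_betw_def)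
      also have "\<dots> = (\<lambda>x. f ` {a, x}) ` P"
        using fa by (simp add: image_image)
      finally have "f ` e \<in> (\<lambda>x. {a', x}) ` P' \<longleftrightarrow> (\<exists>x\<in>P. f ` e = f ` {a, x})"
        by (auto simp: image_iff)
      also have "\<dots> \<longleftrightarrow> (\<exists>x\<in>P. e = {a, x})"
      proof (intro bex_cong refl)
        fix x assume "x \<in> P"
        then have "{a, x} \<subseteq> V" using assms(2,3) by auto
        then show "f ` e = f ` {a, x} \<longleftrightarrow> e = {a, x}" by (rule inj_on_image_eq_iff[OF inj e])
      qed
      finally show ?thesis by (auto simp: image_iff)
    qed
    ultimately show ?thesis by (simp add: pendent_clique_def)
  qed
  then show ?thesis using bij unfolding graph_iso_def by blast
qed

theorem theorem3p7:
  fixes V :: "'a set" and E :: "'a set set" and n r :: nat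
  assumes "n \<ge> 3" and "r \<le> n - 3"
    and "simple_graph V E" and "card V = n" and "connected_graph V E"
    and "num_cut_edges V E = r"
    and "\<forall>V' (E' :: 'a set set). simple_graph V' E' \<and> card V' = n \<and> connected_graph V' E'
           \<and> num_cut_edges V' E' = r \<longrightarrow> sombor E' \<le> sombor E"
  shows "graph_iso V E (kpend_vertices n) (kpend_edges n r)"
proof -
  interpret simple_connected_graph V E using assms by unfold_locales
  have B: "card B = r" using assms(6) by (simp add: B_def num_cut_edges_def)
  \<comment> \<open>Any \<open>r\<close> vertices serve as leaves: the competitor is built on
    \<open>V\<close> itself, so the maximality hypothesis covers it.\<close>
  obtain P where P: "P \<subseteq> V" "card P = r"
    using obtain_subset_with_card_n[of r V] assms by (metis diff_le_self le_trans)
  have card_W: "card (V - P) = n - r"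
    using P assms(4) finite_V by (metis card_Diff_subset finite_subset)
  then have "card (V - P) \<noteq> 0" using assms by linarith
  then obtain a where a: "a \<in> V - P" by (metis card.empty all_not_in_conv)
  interpret ext: pendent_clique_graph V P a
    using finite_V P a card_W assms by unfold_locales auto
  have m_eq: "m = card (V - P) - 1" using card_W B assms(4) by (simp add: m_def)
  have "sombor (pendent_clique V P a) \<le> sombor E"
    using assms(4,7) ext.simple ext.connected ext.num_cut_edges P by blast
  \<comment> \<open>The competitor's index is exactly the upper bound, so \<open>E\<close> attains
    it and has the extremal structure.\<close>
  then have "max_sombor (real m) (real (card B)) \<le> sombor E"
    using ext.sombor_eq m_eq P B by simp
  moreover have "2 \<le> m" using m_eq card_W assms by linarith
  ultimately obtain P' a' where E: "P' \<subseteq> V" "a' \<in> V - P'" "card P' = r" "E = pendent_clique V P' a'"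
    using extremal_structure B by auto
  have "graph_iso V (pendent_clique V P' a') {0..<n} (pendent_clique {0..<n} {n - r..<n} 0)"
    using E assms finite_V by (intro pendent_clique_iso) auto
  moreover have "r < n" using assms by linarith
  ultimately show ?thesis using E(4) by (simp add: kpend_edges_eq kpend_vertices_def)
qed

end
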